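(* Let $0<\varepsilon<1$, $0<\delta<1$, $2\le s\le 2^{d+1}$, let $\Lambda=\Lambda^{\mathrm{HC}}_{d,s}$ be the hyperbolic cross, let $\{\phi_{\boldsymbol i}\}_{\boldsymbol i\in\mathbb N_0^d}$ be the tensor Legendre or tensor Chebyshev polynomial basis, and let $\boldsymbol t_1,\dots,\boldsymbol t_m$ be drawn independently according to the corresponding measure $\nu$, with $$m\asymp s^{\gamma}L(s,n,\delta,\varepsilon).$$ Then, for every $\boldsymbol e\in\mathbb C^m$ and $\eta\ge0$, the quantity $$\mathcal T=\mathcal T(\boldsymbol A,\Lambda,\boldsymbol e,\boldsymbol u,\eta):=\min\left\{\frac{\|\boldsymbol z\|_{1,\boldsymbol u}}{s^{\gamma/2}}:\ \boldsymbol z\in\mathbb C^n,\ \|\boldsymbol A\boldsymbol z-\boldsymbol e\|_2\le\eta\right\}$$ satisfies $$\mathcal T\ \lesssim\ \frac{s^{\alpha/2}\sqrt{L(s,n,\delta,\varepsilon)}}{\sigma_m\big(\sqrt{\tfrac mn}\,\boldsymbol A^*\big)}\ \max\{\|\boldsymbol e\|_2-\eta,0\},$$ where $\alpha=1$ in the Chebyshev case and $\alpha=2$ in the Legendre case.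
   Context: Setting. $d\in\mathbb N$, $D=(-1,1)^d$, $\mathbb N_0=\{0,1,2,\dots\}$. The measure $\nu$ on $D$ is $d\nu=2^{-d}d\boldsymbol t$ (Legendre case) or $d\nu=\prod_{\ell=1}^d\frac{1}{\pi\sqrt{1-t_\ell^2}}d\boldsymbol t$ (Chebyshev case). $\{\phi_{\boldsymbol i}\}_{\boldsymbol i\in\mathbb N_0^d}$ is the tensor product of the corresponding univariate orthonormal polynomials, an orthonormal basis of $L^2_\nu(D)$. Weights: $u_{\boldsymbol i}=\|\phi_{\boldsymbol i}\|_{L^\infty}$, i.e. $u_{\boldsymbol i}=\prod_{\ell=1}^d\sqrt{2i_\ell+1}$ (Legendre) and $u_{\boldsymbol i}=2^{\|\boldsymbol i\|_0/2}$ (Chebyshev, $\|\boldsymbol i\|_0$ the number of nonzero entries). $\|\boldsymbol z\|_{1,\boldsymbol u}=\sum_{\boldsymbol i}u_{\boldsymbol i}|z_{\boldsymbol i}|$; for $S\subseteq\mathbb N_0^d$, $|S|_{\boldsymbol u}=\sum_{\boldsymbol i\in S}u_{\boldsymbol i}^2$. A set $S\subseteq\mathbb N_0^d$ is lower if $\boldsymbol i\in S$ and $\boldsymbol j\le\boldsymbol i$ componentwise imply $\boldsymbol j\in S$. $K(s)=\max\{|S|_{\boldsymbol u}:S\subseteq\mathbb N_0^d\text{ lower},\ |S|\le s\}$. $\gamma=2$ (Legendre), $\gamma=\ln3/\ln2$ (Chebyshev). $\Lambda^{\mathrm{HC}}_{d,s}=\{\boldsymbol i\in\mathbb N_0^d:\prod_{\ell=1}^d(i_\ell+1)\le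 s\}$, $n=|\Lambda|$, with enumeration $\boldsymbol i_1,\dots,\boldsymbol i_n$; vectors in $\mathbb C^n$ are indexed by $\Lambda$. $\boldsymbol A\in\mathbb C^{m\times n}$, $A_{ij}=\frac1{\sqrt m}\phi_{\boldsymbol i_j}(\boldsymbol t_i)$; throughout $m<n$. $\sigma_m(\sqrt{m/n}\,\boldsymbol A^* )$ is the $m$-th singular value, in decreasing order, of the $n\times m$ matrix $\sqrt{m/n}\,\boldsymbol A^*$. $$L(s,n,\delta,\varepsilon)=\frac1{\delta^2}\ln\Big(\frac{K(s)}{\delta^2}\Big)\max\Big\{\frac1{\delta^4}\ln\Big(\frac{K(s)}{\delta^2}\ln\Big(\frac{K(s)}{\delta^2}\Big)\Big)\ln(n),\ \frac1\delta\ln\Big(\frac1{\delta\varepsilon}\ln\Big(\frac{K(s)}{\delta^2}\Big)\Big)\Big\}.$$ Notation: $X\lesssim Y$ means $X\le CY$ for a constant $C>0$ independent of all the quantities involved; $X\asymp Y$ means $X\lesssim Y$ and $Y\lesssim X$. The constant in the conclusion depends only on the constants in the hypothesis $m\asymp s^\gamma L$. When $\sigma_m(\sqrt{m/n}\boldsymbol A^* )=0$, the right-hand side of the bound is read as $+\infty$ if $\|\boldsymbol e\|_2>\eta$ and as $0$ if $\|\boldsymbol e\|_2\le\eta$. *)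

theory Defs
  imports
    "HOL-Probability.Probability"
    "HOL-Probability.Essential_Supremum"
    "Jordan_Normal_Form.Char_Poly"
    "Jordan_Normal_Form.Schur_Decomposition"
begin

unbundle no vec_syntax
hide_type (open) Finite_Cartesian_Product.vec
hide_const (open) Finite_Cartesian_Product.mat Finite_Cartesian_Product.vec

datatype basis = Legendre | Chebyshev

(* Points of D = (-1,1)^d are functions nat => real on {..<d} (undefined outside, as usual
   for Pi_M); multi-indices in N_0^d are functions nat => nat vanishing outside {..<d}, so
   the componentwise order is the order on functions. *)

fun nu_density :: "basis \<Rightarrow> real \<Rightarrow> real" where
  "nu_density Legendre x = 1 / 2"
| "nu_density Chebyshev x = 1 / (pi * sqrt (1 - x\<^sup>2))"

definition nu :: "basis \<Rightarrow> nat \<Rightarrow> (nat \<Rightarrow> real) measure" where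
  "nu b d = density (\<Pi>\<^sub>M l\<in>{..<d}. restrict_space lborel {-1<..<1})
              (\<lambda>t. ennreal (\<Prod>l<d. nu_density b (t l)))"

fun legendre_P :: "nat \<Rightarrow> real \<Rightarrow> real" where
  "legendre_P 0 x = 1"
| "legendre_P (Suc 0) x = x"
| "legendre_P (Suc (Suc k)) x =
     ((2 * real k + 3) * x * legendre_P (Suc k) x - (real k + 1) * legendre_P k x) / (real k + 2)"

definition chebyshev_T :: "nat \<Rightarrow> real \<Rightarrow> real" where
  "chebyshev_T k x = cos (real k * arccos x)"

fun phi1 :: "basis \<Rightarrow> nat \<Rightarrow> real \<Rightarrow> real" where
  "phi1 Legendre k x = sqrt (2 * real k + 1) * legendre_P k x"
| "phi1 Chebyshev k x = (if k = 0 then 1 else sqrt 2) * chebyshev_T k x"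

definition phi :: "basis \<Rightarrow> nat \<Rightarrow> (nat \<Rightarrow> nat) \<Rightarrow> (nat \<Rightarrow> real) \<Rightarrow> real" where
  "phi b d i t = (\<Prod>l<d. phi1 b (i l) (t l))"

definition weight :: "basis \<Rightarrow> nat \<Rightarrow> (nat \<Rightarrow> nat) \<Rightarrow> real" where
  "weight b d i = real_of_ereal (esssup (nu b d) (\<lambda>t. ereal \<bar>phi b d i t\<bar>))"

definition multi_indices :: "nat \<Rightarrow> (nat \<Rightarrow> nat) set" where
  "multi_indices d = {i. \<forall>l\<ge>d. i l = 0}"

definition lower_set :: "nat \<Rightarrow> (nat \<Rightarrow> nat) set \<Rightarrow> bool" where
  "lower_set d S \<longleftrightarrow> S \<subseteq> multi_indices d \<and> (\<forall>i\<in>S. \<forall>j. j \<le> i \<longrightarrow> j \<in> S)"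

definition weighted_card :: "basis \<Rightarrow> nat \<Rightarrow> (nat \<Rightarrow> nat) set \<Rightarrow> real" where
  "weighted_card b d S = (\<Sum>i\<in>S. (weight b d i)\<^sup>2)"

definition Ks :: "basis \<Rightarrow> nat \<Rightarrow> nat \<Rightarrow> real" where
  "Ks b d s = Max {weighted_card b d S | S. lower_set d S \<and> finite S \<and> card S \<le> s}"

definition hyperbolic_cross :: "nat \<Rightarrow> nat \<Rightarrow> (nat \<Rightarrow> nat) set" where
  "hyperbolic_cross d s = {i \<in> multi_indices d. (\<Prod>l<d. i l + 1) \<le> s}"

fun gamma_exp :: "basis \<Rightarrow> real" where
  "gamma_exp Legendre = 2"
| "gamma_exp Chebyshev = ln 3 / ln 2"

fun alpha_exp :: "basis \<Rightarrow> real" where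
  "alpha_exp Legendre = 2"
| "alpha_exp Chebyshev = 1"

definition Lfac :: "basis \<Rightarrow> nat \<Rightarrow> nat \<Rightarrow> nat \<Rightarrow> real \<Rightarrow> real \<Rightarrow> real" where
  "Lfac b d s n \<delta> \<epsilon> = 1 / \<delta>\<^sup>2 * ln (Ks b d s / \<delta>\<^sup>2) *
     max (1 / \<delta> ^ 4 * ln (Ks b d s / \<delta>\<^sup>2 * ln (Ks b d s / \<delta>\<^sup>2)) * ln (real n))
         (1 / \<delta> * ln (1 / (\<delta> * \<epsilon>) * ln (Ks b d s / \<delta>\<^sup>2)))"

(* idx enumerates Lambda and t 0, ..., t (m - 1) are the sample points. *)
definition sampling_matrix ::
  "basis \<Rightarrow> nat \<Rightarrow> (nat \<Rightarrow> nat) list \<Rightarrow> nat \<Rightarrow> (nat \<Rightarrow> nat \<Rightarrow> real) \<Rightarrow> complex mat" where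
  "sampling_matrix b d idx m t =
     mat m (length idx) (\<lambda>(k, j). complex_of_real (1 / sqrt (real m) * phi b d (idx ! j) (t k)))"

definition norm2 :: "complex vec \<Rightarrow> real" where
  "norm2 v = L2_set (\<lambda>k. cmod (v $ k)) {..<dim_vec v}"

definition norm1w :: "basis \<Rightarrow> nat \<Rightarrow> (nat \<Rightarrow> nat) list \<Rightarrow> complex vec \<Rightarrow> real" where
  "norm1w b d idx z = (\<Sum>j<length idx. weight b d (idx ! j) * cmod (z $ j))"

(* Square roots of the eigenvalues of B^* B with algebraic multiplicity, in decreasing order.
   If B has more columns than rows, the list is padded with zeros. *)
definition singular_values :: "complex mat \<Rightarrow> real list" where
  "singular_values B = rev (sorted_list_of_multiset
     (image_mset (\<lambda>x. sqrt (Re x)) (proots (char_poly (mat_adjoint B * B)))))"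

definition singular_value :: "nat \<Rightarrow> complex mat \<Rightarrow> real" where
  "singular_value k B = singular_values B ! (k - 1)"

(* The minimum is taken in ereal, so that it is infinite when no z is feasible. *)
definition Tquant :: "basis \<Rightarrow> nat \<Rightarrow> nat \<Rightarrow> (nat \<Rightarrow> nat) list \<Rightarrow> complex mat \<Rightarrow> complex vec \<Rightarrow>
    real \<Rightarrow> ereal" where
  "Tquant b d s idx A e \<eta> =
     (INF z\<in>{z \<in> carrier_vec (length idx). norm2 (A *\<^sub>v z - e) \<le> \<eta>}.
        ereal (norm1w b d idx z / real s powr (gamma_exp b / 2)))"

lemma legendre_P_1 [simp]: "legendre_P k 1 = 1"
  by (induction k "1::real" rule: legendre_P.induct) (auto simp: field_simps)

lemma continuous_on_legendre_P: "continuous_on A (legendre_P k)"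
proof (induction k rule: induct_nat_012)
  case 0 show ?case by (simp add: continuous_on_const)
next
  case 1 
  have "legendre_P (Suc 0) = (\<lambda>x. x)" by auto
  then show ?case by (simp add: continuous_on_id)
next
  case (ge2 k)
  show ?case by (simp, intro continuous_intros ge2.IH) auto
qed

lemma legendre_cos:
  "complex_of_real (legendre_P n (cos \<theta>)) =
     (\<Sum>k\<le>n. (complex_of_real (pochhammer (1/2) k / fact k) * cis \<theta> ^ k) *
            (complex_of_real (pochhammer (1/2) (n - k) / fact (n - k)) * cis (-\<theta>) ^ (n - k)))"
proof -
  define a where "a k = complex_of_real (pochhammer (1/2) k / fact k)" for k
  have a_Suc: "of_nat (Suc k) * a (Suc k) = (1/2 + of_nat k) * a k" for k
  proof -
    have "real (Suc k) * (pochhammer (1/2) (Suc k) / fact (Suc k)) = (1/2 + real k) * (pochhammer (1/2) k / fact k)"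
      by (simp add: pochhammer_Suc field_simps del: of_nat_Suc)
    from arg_cong[OF this, of complex_of_real] show ?thesis
      unfolding a_def
      by (simp only: of_real_mult of_real_add of_real_divide of_real_of_nat_eq of_real_1 of_real_numeral)
  qed
  define F where "F w = Abs_fps (\<lambda>k. a k * w ^ k)" for w
  have D: "(1 - fps_const w * fps_X) * fps_deriv (F w) = fps_const (w/2) * F w" for w
  proof (intro fps_ext)
    fix k
    have *: "of_nat (Suc k) * a (Suc k) * w ^ Suc k - w * (of_nat k * a k * w ^ k) = w / 2 * (a k * w ^ k)" for k
      unfolding a_Suc by (simp add: algebra_simps)
    show "fps_nth ((1 - fps_const w * fps_X) * fps_deriv (F w)) k = fps_nth (fps_const (w/2) * F w) k"
      using *[of k]
      by (cases k) (simp_all add: left_diff_distrib mult.assoc F_def del: of_nat_Suc)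
  qed
  define w v where "w = cis \<theta>" and "v = cis (-\<theta>)"
  have wv: "w * v = 1" "w + v = 2 * complex_of_real (cos \<theta>)"
    by (simp_all add: w_def v_def cis_mult complex_eq_iff)
  define G where "G = F w * F v"
  define x where "x = complex_of_real (cos \<theta>)"
  have gen1: "P * Q * fps_deriv G = (P * fps_deriv (F w)) * Q * F v + (Q * fps_deriv (F v)) * P * F w" for P Q
    by (simp add: G_def algebra_simps)
  have gen2: "P * F w * Q * F v + R * F v * S * F w = (P * Q + R * S) * G" for P Q R S
    by (simp add: G_def algebra_simps)
  have gen3: "P * (1 - Q * Z) + R * (1 - S * Z) = (P + R) - (P * Q + R * S) * Z" for P Q R S Z :: "complex fps"
    by (simp add: algebra_simps)
  have gen4: "(1 - P * Z) * (1 - Q * Z) = 1 - (P + Q) * Z + (P * Q) * (Z * Z)" for P Q Z :: "complex fps"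
    by (simp add: algebra_simps)
  have "(1 - fps_const w * fps_X) * (1 - fps_const v * fps_X) * fps_deriv G =
      ((1 - fps_const w * fps_X) * fps_deriv (F w)) * (1 - fps_const v * fps_X) * F v +
      ((1 - fps_const v * fps_X) * fps_deriv (F v)) * (1 - fps_const w * fps_X) * F w"
    using gen1 .
  also have "\<dots> = (fps_const (w/2) * (1 - fps_const v * fps_X) + fps_const (v/2) * (1 - fps_const w * fps_X)) * G"
    unfolding D using gen2 .
  also have "fps_const (w/2) * (1 - fps_const v * fps_X) + fps_const (v/2) * (1 - fps_const w * fps_X)
     = fps_const ((w + v)/2) - fps_const (w * v) * fps_X"
    unfolding gen3 by (simp add: add_divide_distrib mult.commute)
  also have "\<dots> = fps_const x - fps_X" by (simp add: wv x_def)
  also have "(1 - fps_const w * fps_X) * (1 - fps_const v * fps_X) = 1 - fps_const (w + v) * fps_X + fps_const (w * v) * (fps_X * fps_X)"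
    unfolding gen4 by simp
  also have "\<dots> = 1 - fps_const (2 * x) * fps_X + fps_X * fps_X" by (simp add: wv x_def)
  finally have E: "(1 - fps_const (2 * x) * fps_X + fps_X * fps_X) * fps_deriv G = (fps_const x - fps_X) * G" .
  have G0: "fps_nth G 0 = 1" by (simp add: G_def F_def a_def)
  have G1: "fps_nth G (Suc 0) = x"
    using arg_cong[OF E, of "\<lambda>f. fps_nth f 0"] G0
    by (simp add: fps_mult_nth)
  have G2: "fps_nth G (Suc (Suc k)) = ((2 * of_nat k + 3) * x * fps_nth G (Suc k) - (of_nat k + 1) * fps_nth G k) / (of_nat k + 2)" for k
  proof -
    have nz: "of_nat k + 2 \<noteq> (0::complex)"
      by (metis of_nat_Suc of_nat_add of_nat_eq_0_iff of_nat_numeral add_2_eq_Suc' nat.distinct(1))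
    have "fps_nth ((1 - fps_const (2 * x) * fps_X + fps_X * fps_X) * fps_deriv G) (Suc k) = 
       fps_nth ((fps_const x - fps_X) * G) (Suc k)" by (simp only: E)
    then have "(of_nat k + 2) * fps_nth G (Suc (Suc k)) - 2 * x * ((of_nat k + 1) * fps_nth G (Suc k)) + of_nat k * fps_nth G k
       = x * fps_nth G (Suc k) - fps_nth G k"
      by (cases k) (simp_all add: distrib_right left_diff_distrib mult.assoc add_ac)
    then show ?thesis using nz by (simp add: field_simps)
  qed
  have "complex_of_real (legendre_P n (cos \<theta>)) = fps_nth G n"
  proof (induction n rule: induct_nat_012)
    case (ge2 k)
    show ?case unfolding G2 ge2.IH[symmetric] by (simp add: x_def)
  qed (simp_all add: G0 G1 x_def)
  then show ?thesis
    by (simp add: G_def F_def fps_mult_nth a_def w_def v_def atLeast0AtMost)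
qed

lemma abs_legendre_P_le_1:
  assumes "\<bar>x\<bar> \<le> 1"
  shows "\<bar>legendre_P n x\<bar> \<le> 1"
proof -
  define p where "p k = pochhammer (1/2::real) k / fact k" for k
  have p: "p k \<ge> 0" for k by (simp add: p_def pochhammer_nonneg)
  have x: "x = cos (arccos x)" using assms by simp
  have "\<bar>legendre_P n x\<bar> = cmod (complex_of_real (legendre_P n (cos (arccos x))))"
    using x by simp
  also have "\<dots> \<le> (\<Sum>k\<le>n. p k * p (n - k))"
    unfolding legendre_cos p_def[symmetric]
    by (rule order.trans[OF norm_sum]) (simp add: norm_mult norm_power p)
  also have "\<dots> = 1"
    using legendre_cos[of n 0] unfolding p_def[symmetric]
    by (simp flip: of_real_mult of_real_sum)
  finally show ?thesis .
qed

lemma phi1_at_1: "phi1 b k 1 = (case b of Legendre \<Rightarrow> sqrt (2 * real k + 1) 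
     | Chebyshev \<Rightarrow> if k = 0 then 1 else sqrt 2)"
  by (cases b) (auto simp: chebyshev_T_def)

lemma phi1_at_1_pos: "phi1 b k 1 > 0"
  by (cases b) (auto simp: chebyshev_T_def)

lemma abs_phi1_le:
  assumes "\<bar>x\<bar> \<le> 1" shows "\<bar>phi1 b k x\<bar> \<le> phi1 b k 1"
  using abs_legendre_P_le_1[OF assms]
  by (cases b) (auto simp: chebyshev_T_def abs_mult mult_left_le)

lemma continuous_on_phi1: "continuous_on {-1..1} (phi1 b k)"
proof (cases b)
  case Legendre
  then show ?thesis
    by (simp, intro continuous_intros continuous_on_legendre_P)
next
  case Chebyshev
  have "continuous_on {-1..1} (\<lambda>x. (if k = 0 then 1 else sqrt 2) * cos (real k * arccos x))"
    by (intro continuous_intros) auto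
  with Chebyshev show ?thesis by (simp add: chebyshev_T_def)
qed

abbreviation leb1 :: "real measure" where "leb1 \<equiv> restrict_space lborel {-1<..<1}"

lemma product_sigma_finite_leb1: "product_sigma_finite (\<lambda>l::nat. leb1)"
  by (auto simp: product_sigma_finite_def sigma_finite_lborel intro!: sigma_finite_measure_restrict_space)

lemma phi1_measurable: "phi1 b k \<in> borel_measurable leb1"
proof -
  have "phi1 b k \<in> borel_measurable (restrict_space borel {-1<..<1})"
    by (intro borel_measurable_continuous_on_restrict continuous_on_subset[OF continuous_on_phi1]) auto
  then show ?thesis by (simp add: measurable_def space_restrict_space sets_restrict_space)
qed

lemma nu_density_measurable: "nu_density b \<in> borel_measurable leb1"
proof -
  have *: "nu_density b \<in> borel_measurable borel"
    by (cases b) (simp_all add: fun_eq_iff cong: measurable_cong)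
  then show ?thesis by (intro measurable_restrict_space1) simp
qed

lemma sets_nu [simp]: "sets (nu b d) = sets (\<Pi>\<^sub>M l\<in>{..<d}. leb1)"
  by (simp add: nu_def)

lemma space_nu: "space (nu b d) = ({..<d} \<rightarrow>\<^sub>E {-1<..<1})"
  by (simp add: nu_def space_PiM space_restrict_space)

lemma phi_measurable: "phi b d i \<in> borel_measurable (nu b d)"
proof -
  have "(\<lambda>t. \<Prod>l<d. phi1 b (i l) (t l)) \<in> borel_measurable (\<Pi>\<^sub>M l\<in>{..<d}. leb1)"
    by (intro borel_measurable_prod measurable_compose[OF _ phi1_measurable]
          measurable_component_singleton) auto
  then show ?thesis
    unfolding phi_def[abs_def] by (simp add: nu_def cong: measurable_cong_sets)
qed

lemma nu_prod_measurable:
  "(\<lambda>t. ennreal (\<Prod>l<d. nu_density b (t l))) \<in> borel_measurable (\<Pi>\<^sub>M l\<in>{..<d}. leb1)"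
  by (intro measurable_compose[OF _ measurable_ennreal] borel_measurable_prod
        measurable_compose[OF _ nu_density_measurable] measurable_component_singleton) auto

lemma nu_density_pos: "\<bar>x\<bar> < 1 \<Longrightarrow> nu_density b x > 0"
  by (cases b) (auto simp: abs_square_less_1)

(* The L^infinity norm of phi is its value at the corner (1,...,1). *)
lemma weight_eq_prod: "weight b d i = (\<Prod>l<d. phi1 b (i l) 1)" (is "_ = ?u")
proof -
  interpret product_sigma_finite "\<lambda>l::nat. leb1" by (rule product_sigma_finite_leb1)
  let ?N = "\<Pi>\<^sub>M l\<in>{..<d}. leb1"
  define c where "c = esssup (nu b d) (\<lambda>t. ereal \<bar>phi b d i t\<bar>)"
  have u0: "?u > 0" by (intro prod_pos) (auto simp: phi1_at_1_pos)
  have "c \<le> ereal ?u"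
    unfolding c_def
  proof (rule esssup_I)
    show "(\<lambda>t. ereal \<bar>phi b d i t\<bar>) \<in> borel_measurable (nu b d)"
      using phi_measurable by measurable
    show "AE t in nu b d. ereal \<bar>phi b d i t\<bar> \<le> ereal ?u"
    proof (rule AE_I2)
      fix t assume "t \<in> space (nu b d)"
      then have "\<bar>t l\<bar> \<le> 1" if "l < d" for l using that by (force simp: space_nu PiE_iff)
      then show "ereal \<bar>phi b d i t\<bar> \<le> ereal ?u"
        by (auto simp: phi_def abs_prod intro!: prod_mono abs_phi1_le)
    qed
  qed
  moreover have "\<not> c < ereal ?u"
  proof
    assume "c < ereal ?u"
    then obtain r where r: "c < ereal r" "r < ?u"
      using ereal_dense2[of c "ereal ?u"] by auto
    have "((\<lambda>q. q ^ d * ?u) \<longlongrightarrow> 1 ^ d * ?u) (at_left (1::real))"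
      by (intro tendsto_intros)
    then have "eventually (\<lambda>q. r < q ^ d * ?u) (at_left (1::real))"
      using r by (intro order_tendstoD) auto
    moreover have "eventually (\<lambda>q. q \<in> {0<..<1}) (at_left (1::real))"
      by (rule eventually_at_left_real) auto
    ultimately have "eventually (\<lambda>q. r < q ^ d * ?u \<and> q \<in> {0<..<1}) (at_left (1::real))"
      by (rule eventually_conj)
    then obtain q where q: "r < q ^ d * ?u" "0 < q" "q < 1"
      using eventually_happens'[OF trivial_limit_at_left_real] by fastforce
    have "eventually (\<lambda>x. phi1 b (i l) x > q * phi1 b (i l) 1) (at_left 1)" for l
    proof -
      have "(phi1 b (i l) \<longlongrightarrow> phi1 b (i l) 1) (at 1 within {-1..1})"
        using continuous_on_phi1[of b "i l"] by (simp add: continuous_on)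
      then have "(phi1 b (i l) \<longlongrightarrow> phi1 b (i l) 1) (at_left 1)"
        using at_within_Icc_at_left[of "-1" "1::real"] by simp
      then show ?thesis
        using q phi1_at_1_pos[of b "i l"] by (intro order_tendstoD) auto
    qed
    then have "eventually (\<lambda>x. \<forall>l\<in>{..<d}. phi1 b (i l) x > q * phi1 b (i l) 1) (at_left 1)"
      by (intro eventually_ball_finite) auto
    then obtain y where y: "y < 1" "\<And>x l. y < x \<Longrightarrow> x < 1 \<Longrightarrow> l < d \<Longrightarrow> phi1 b (i l) x > q * phi1 b (i l) 1"
      by (auto simp: eventually_at_left_field)
    define y' where "y' = max y 0"
    have y': "y' < 1" "y' \<ge> 0" "y' \<ge> y" using y(1) by (auto simp: y'_def)
    define B where "B = ({..<d} \<rightarrow>\<^sub>E {y'<..<1})"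
    have meas: "{y'<..<1} \<in> sets leb1"
      using y' by (auto simp: sets_restrict_space_iff)
    have "emeasure ?N B = (\<Prod>l<d. emeasure leb1 {y'<..<1})"
      unfolding B_def by (intro emeasure_PiM) (auto intro: meas)
    also have "emeasure leb1 {y'<..<1} = ennreal (1 - y')"
      using y' by (subst emeasure_restrict_space) auto
    also have "(\<Prod>l<d. ennreal (1 - y')) = ennreal ((1 - y') ^ d)"
      using y' by (simp add: ennreal_power)
    finally have emB: "emeasure ?N B = ennreal ((1 - y') ^ d)" .
    have "AE t in nu b d. ereal \<bar>phi b d i t\<bar> \<le> c"
      unfolding c_def by (rule esssup_AE)
    then have "AE t in ?N. 0 < ennreal (\<Prod>l<d. nu_density b (t l)) \<longrightarrow> ereal \<bar>phi b d i t\<bar> \<le> c"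
      unfolding nu_def by (simp add: AE_density[OF nu_prod_measurable])
    then have ae: "AE t in ?N. t \<notin> B"
    proof (rule eventually_mono, intro notI)
      fix t assume *: "0 < ennreal (\<Prod>l<d. nu_density b (t l)) \<longrightarrow> ereal \<bar>phi b d i t\<bar> \<le> c"
        and t: "t \<in> B"
      have tl: "y' < t l" "t l < 1" if "l < d" for l using t that by (auto simp: B_def PiE_iff)
      have "0 < (\<Prod>l<d. nu_density b (t l))"
      proof (intro prod_pos ballI nu_density_pos)
        fix l assume "l \<in> {..<d}"
        then show "\<bar>t l\<bar> < 1" using tl[of l] y' by auto
      qed
      then have 1: "ereal \<bar>phi b d i t\<bar> \<le> c" using * by simp
      have "q ^ d * ?u \<le> phi b d i t"
      proof -
        have "q ^ d * ?u = (\<Prod>l<d. q * phi1 b (i l) 1)" by (simp add: prod.distrib)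
        also have "\<dots> \<le> phi b d i t"
          unfolding phi_def
        proof (intro prod_mono conjI)
          fix l assume "l \<in> {..<d}"
          then show "q * phi1 b (i l) 1 \<le> phi1 b (i l) (t l)"
            using tl[of l] y' by (intro less_imp_le y(2)) auto
          show "0 \<le> q * phi1 b (i l) 1" using q phi1_at_1_pos[of b "i l"] by simp
        qed
        finally show ?thesis .
      qed
      then have "ereal r \<le> ereal \<bar>phi b d i t\<bar>" using q by simp
      then have "ereal r \<le> c" using 1 by (rule order.trans)
      then show False using r(1) leD by blast
    qed
    have eq: "{t \<in> space ?N. \<not> t \<notin> B} = B"
    proof -
      have "B \<subseteq> ({..<d} \<rightarrow>\<^sub>E {-1<..<1})"
        unfolding B_def using y' by (intro PiE_mono) auto
      also have "\<dots> = space ?N" by (simp add: space_PiM space_restrict_space)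
      finally show ?thesis by blast
    qed
    have ms: "B \<in> sets ?N"
      unfolding B_def by (intro sets_PiM_I_finite) (auto intro: meas)
    have "emeasure ?N B = 0"
      using AE_iff_measurable[OF ms eq] ae by (rule iffD1)
    then show False using emB y' by simp
  qed
  ultimately have "c = ereal ?u" by auto
  then show ?thesis by (simp add: weight_def c_def)
qed

lemma weight_Legendre: "weight Legendre d i = (\<Prod>l<d. sqrt (2 * real (i l) + 1))"
  by (simp add: weight_eq_prod)

lemma weight_Chebyshev: "weight Chebyshev d i = 2 powr (real (card {l. l < d \<and> i l \<noteq> 0}) / 2)"
proof -
  have "weight Chebyshev d i = (\<Prod>l<d. if i l \<noteq> 0 then sqrt 2 else 1)"
    unfolding weight_eq_prod by (intro prod.cong) (auto simp: chebyshev_T_def)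
  also have "\<dots> = sqrt 2 ^ card {l. l < d \<and> i l \<noteq> 0}"
    by (subst prod.If_cases) (auto simp: Int_def conj_commute intro!: arg_cong[where f = card])
  also have "\<dots> = 2 powr (real (card {l. l < d \<and> i l \<noteq> 0}) / 2)"
    by (simp add: powr_half_sqrt[symmetric] powr_realpow[symmetric] powr_powr)
  finally show ?thesis .
qed


lemma nn_integral_nu_density: "(\<integral>\<^sup>+x. ennreal (nu_density b x) \<partial>leb1) = 1"
proof (cases b)
  case Legendre
  have "emeasure leb1 {-1<..<1} = 2" by (subst emeasure_restrict_space) auto
  then have "emeasure leb1 (space leb1) = 2" by (simp add: space_restrict_space)
  moreover have "ennreal (1/2) * 2 = 1"
    using ennreal_mult[of "1/2" 2] by simp
  ultimately show ?thesis using Legendre by simp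
next
  case Chebyshev
  let ?f = "\<lambda>x::real. 1 / (pi * sqrt (1 - x\<^sup>2))"
  have pos: "0 < 1 - x\<^sup>2" if "-1 < x" "x < 1" for x :: real
    using that by (simp add: abs_square_less_1)
  have der: "DERIV (\<lambda>x. arcsin x / pi) x :> ?f x" if "-1 < x" "x < 1" for x
    using that pos[OF that] by (auto intro!: derivative_eq_intros simp: field_simps)
  have cont: "isCont ?f x" if "-1 < x" "x < 1" for x
    using pos[OF that] by (intro continuous_intros) auto
  have "((\<lambda>x. arcsin x / pi) \<longlongrightarrow> arcsin (-1) / pi) (at_right (-1))"
       "((\<lambda>x. arcsin x / pi) \<longlongrightarrow> arcsin 1 / pi) (at_left 1)"
  proof -
    have c: "continuous_on {-1..1} (\<lambda>x. arcsin x / pi)" by (intro continuous_intros) auto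
    show "((\<lambda>x. arcsin x / pi) \<longlongrightarrow> arcsin (-1) / pi) (at_right (-1))"
      using bspec[OF c[unfolded continuous_on], of "-1"] at_within_Icc_at_right[of "-1" "1::real"] by simp
    show "((\<lambda>x. arcsin x / pi) \<longlongrightarrow> arcsin 1 / pi) (at_left 1)"
      using bspec[OF c[unfolded continuous_on], of 1] at_within_Icc_at_left[of "-1" "1::real"] by simp
  qed
  then have lims: "(((\<lambda>x. arcsin x / pi) \<circ> real_of_ereal) \<longlongrightarrow> - (1/2)) (at_right (ereal (-1)))"
       "(((\<lambda>x. arcsin x / pi) \<circ> real_of_ereal) \<longlongrightarrow> 1/2) (at_left (ereal 1))"
    by (simp_all add: ereal_tendsto_simps)
  have nn: "AE x in lborel. ereal (-1) < ereal x \<longrightarrow> ereal x < ereal 1 \<longrightarrow> 0 \<le> ?f x"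
    using pos by (intro AE_I2) (auto simp: less_imp_le)
  note FTC = interval_integral_FTC_nonneg[OF _ _ _ nn lims]
  have int0: "set_integrable lborel (einterval (ereal (-1)) (ereal 1)) ?f"
    by (rule FTC(1)) (simp, (rule der; simp), (rule cont; simp))
  have int1: "(LBINT x=ereal (-1)..ereal 1. ?f x) = 1/2 - (-(1/2))"
    by (rule FTC(2)) (simp, (rule der; simp), (rule cont; simp))
  have ei: "einterval (ereal (-1)) (ereal 1) = {-1<..<1}"
    by (auto simp: einterval_def)
  have int: "set_integrable lborel {-1<..<1} ?f" "(LBINT x:{-1<..<1}. ?f x) = 1"
    using int0 int1 unfolding interval_lebesgue_integral_def ei by simp_all
  have "(\<integral>\<^sup>+x. ennreal (?f x) \<partial>leb1) = (\<integral>\<^sup>+x\<in>{-1<..<1}. ennreal (?f x) \<partial>lborel)"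
    by (subst nn_integral_restrict_space) auto
  also have "\<dots> = (\<integral>\<^sup>+x. ennreal (indicator {-1<..<1} x *\<^sub>R ?f x) \<partial>lborel)"
    by (intro nn_integral_cong) (auto simp: indicator_def)
  also have "\<dots> = ennreal (LBINT x:{-1<..<1}. ?f x)"
    using int(1) pos unfolding set_lebesgue_integral_def set_integrable_def
    by (intro nn_integral_eq_integral) (auto simp: indicator_def less_imp_le)
  finally show ?thesis using Chebyshev int by simp
qed

lemma prob_space_nu: "prob_space (nu b d)"
proof
  interpret product_sigma_finite "\<lambda>l::nat. leb1" by (rule product_sigma_finite_leb1)
  let ?N = "\<Pi>\<^sub>M l\<in>{..<d}. leb1"
  have "emeasure (nu b d) (space (nu b d)) = (\<integral>\<^sup>+t. ennreal (\<Prod>l<d. nu_density b (t l)) \<partial>?N)"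
    unfolding nu_def by (subst emeasure_density) (auto intro!: nn_integral_cong nu_prod_measurable)
  also have "\<dots> = (\<integral>\<^sup>+t. (\<Prod>l<d. ennreal (nu_density b (t l))) \<partial>?N)"
    by (intro nn_integral_cong prod_ennreal[symmetric] less_imp_le nu_density_pos)
       (force simp: space_PiM space_restrict_space PiE_iff)
  also have "\<dots> = (\<Prod>l<d. \<integral>\<^sup>+x. ennreal (nu_density b x) \<partial>leb1)"
    by (intro product_nn_integral_prod) (auto intro: measurable_compose[OF nu_density_measurable])
  finally show "emeasure (nu b d) (space (nu b d)) = 1" by (simp add: nn_integral_nu_density)
qed

lemma weight_pos: "weight b d i > 0"
  unfolding weight_eq_prod by (intro prod_pos) (simp add: phi1_at_1_pos)


lemma lower_set_bound:
  assumes "lower_set d S" "finite S" "i \<in> S"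
  shows "i l < card S"
proof -
  have inj: "inj_on (\<lambda>k. i(l := k)) {..i l}"
    by (auto simp: inj_on_def fun_eq_iff)
  have "(\<lambda>k. i(l := k)) ` {..i l} \<subseteq> S"
    using assms by (auto simp: lower_set_def le_fun_def)
  then have "card ((\<lambda>k. i(l := k)) ` {..i l}) \<le> card S"
    by (intro card_mono assms)
  then show ?thesis by (simp add: card_image[OF inj])
qed

(* So the maximum defining Ks is genuine. *)
lemma finite_Ks_set: "finite {weighted_card b d S | S. lower_set d S \<and> finite S \<and> card S \<le> s}"
proof -
  have "{S. lower_set d S \<and> finite S \<and> card S \<le> s} \<subseteq>
      Pow {i. \<forall>l. (l \<in> {..<d} \<longrightarrow> i l \<in> {..s}) \<and> (l \<notin> {..<d} \<longrightarrow> i l = 0)}"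
  proof
    fix S assume "S \<in> {S. lower_set d S \<and> finite S \<and> card S \<le> s}"
    then have S: "lower_set d S" "finite S" "card S \<le> s" by auto
    have "i l \<le> s" if "i \<in> S" for i l
      using lower_set_bound[OF S(1,2) that, of l] S(3) by simp
    moreover have "i l = 0" if "i \<in> S" "l \<ge> d" for i l
      using S that by (auto simp: lower_set_def multi_indices_def)
    ultimately show "S \<in> Pow {i. \<forall>l. (l \<in> {..<d} \<longrightarrow> i l \<in> {..s}) \<and> (l \<notin> {..<d} \<longrightarrow> i l = 0)}"
      by auto
  qed
  moreover have "finite (Pow {i::nat \<Rightarrow> nat. \<forall>l. (l \<in> {..<d} \<longrightarrow> i l \<in> {..s}) \<and> (l \<notin> {..<d} \<longrightarrow> i l = 0)})"
    by (intro finite_Pow_iff[THEN iffD2] finite_set_of_finite_funs) auto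
  ultimately have "finite {S. lower_set d S \<and> finite S \<and> card S \<le> s}" by (rule finite_subset)
  then have "finite (weighted_card b d ` {S. lower_set d S \<and> finite S \<and> card S \<le> s})" by simp
  then show ?thesis by (simp add: setcompr_eq_image)
qed

(* The infimum in Tquant is a minimum whenever some z is feasible. *)
lemma Tquant_attained:
  assumes A: "A \<in> carrier_mat m (length idx)" and e: "e \<in> carrier_vec m" and s: "s > 0"
    and z0: "z0 \<in> carrier_vec (length idx)" "norm2 (A *\<^sub>v z0 - e) \<le> \<eta>"
  shows "\<exists>z\<in>carrier_vec (length idx). norm2 (A *\<^sub>v z - e) \<le> \<eta> \<and>
           Tquant b d s idx A e \<eta> = ereal (norm1w b d idx z / real s powr (gamma_exp b / 2))"
proof -
  define n where "n = length idx"
  define w where "w j = weight b d (idx ! j)" for j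
  have w: "w j > 0" for j by (simp add: w_def weight_pos)
  define h where "h f = (\<Sum>j<n. w j * cmod (f j))" for f :: "nat \<Rightarrow> complex"
  define g where "g f = L2_set (\<lambda>k. cmod ((\<Sum>j<n. A $$ (k, j) * f j) - e $ k)) {..<m}" for f :: "nat \<Rightarrow> complex"
  have h: "norm1w b d idx z = h (vec_index z)" if "z \<in> carrier_vec n" for z
    by (simp add: norm1w_def h_def w_def n_def)
  have g: "norm2 (A *\<^sub>v z - e) = g (vec_index z)" if "z \<in> carrier_vec n" for z
    unfolding norm2_def g_def using that A e
    by (intro L2_set_cong) (auto simp: n_def scalar_prod_def lessThan_atLeast0)
  have hcont: "continuous_on UNIV h" unfolding h_def
    by (intro continuous_intros continuous_on_product_coordinates)
  have gcont: "continuous_on UNIV g" unfolding g_def L2_set_def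
    by (intro continuous_intros continuous_on_product_coordinates)
  define K where "K = PiE UNIV (\<lambda>j. cball (0::complex) (h (vec_index z0) / w j))"
  have "compact K" 
    unfolding K_def compactin_euclidean_iff[symmetric] euclidean_product_topology[symmetric]
    by (subst compactin_PiE) auto
  moreover have "closed {f. g f \<le> \<eta>}" 
    using gcont by (intro closed_Collect_le continuous_on_const) auto
  ultimately have comp: "compact (K \<inter> {f. g f \<le> \<eta>})" by (rule compact_Int_closed)
  define tr where "tr f = (\<lambda>j. if j < n then f j else 0)" for f :: "nat \<Rightarrow> complex"
  have tr: "h (tr f) = h f" "g (tr f) = g f" for f
    by (simp_all add: h_def g_def tr_def)
  have inK: "tr f \<in> K" if "h f \<le> h (vec_index z0)" for f
    unfolding K_def
  proof (rule PiE_I)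
    fix j
    have h0: "0 \<le> h (vec_index z0)" unfolding h_def by (intro sum_nonneg mult_nonneg_nonneg) (auto simp: w less_imp_le)
    have "w j * cmod (f j) \<le> h f" if "j < n"
      unfolding h_def using that by (intro member_le_sum mult_nonneg_nonneg) (auto simp: w less_imp_le)
    then show "tr f j \<in> cball 0 (h (vec_index z0) / w j)"
      using that h0 w[of j] by (fastforce simp: tr_def field_simps)
  qed auto
  have "tr (vec_index z0) \<in> K \<inter> {f. g f \<le> \<eta>}"
    using z0 inK[of "vec_index z0"] by (simp add: tr g[symmetric] n_def)
  then obtain f where f: "f \<in> K" "g f \<le> \<eta>" "\<And>f'. f' \<in> K \<Longrightarrow> g f' \<le> \<eta> \<Longrightarrow> h f \<le> h f'"
    using continuous_attains_inf[OF comp _ continuous_on_subset[OF hcont]] by blast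
  define z where "z = vec n f"
  have z: "z \<in> carrier_vec n" by (simp add: z_def)
  have hz: "h (vec_index z) = h f" "g (vec_index z) = g f"
    by (simp_all add: h_def g_def z_def)
  have min: "h f \<le> h (vec_index z')" if "z' \<in> carrier_vec n" "norm2 (A *\<^sub>v z' - e) \<le> \<eta>" for z'
  proof (cases "h (vec_index z') \<le> h (vec_index z0)")
    case True
    have "h f \<le> h (tr (vec_index z'))"
      using that by (intro f(3) inK True) (simp add: tr g)
    then show ?thesis by (simp add: tr)
  next
    case False
    have "h f \<le> h (tr (vec_index z0))"
      using z0 by (intro f(3) inK order.refl) (simp add: tr g[symmetric] n_def)
    with False show ?thesis by (simp add: tr)
  qed
  show ?thesis
  proof (intro bexI conjI)
    show feas: "norm2 (A *\<^sub>v z - e) \<le> \<eta>" using f z by (simp add: g hz)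
    show "z \<in> carrier_vec (length idx)" using z by (simp add: n_def)
    show "Tquant b d s idx A e \<eta> = ereal (norm1w b d idx z / real s powr (gamma_exp b / 2))"
      unfolding Tquant_def
    proof (rule antisym)
      show "(INF z\<in>{z \<in> carrier_vec (length idx). norm2 (A *\<^sub>v z - e) \<le> \<eta>}.
          ereal (norm1w b d idx z / real s powr (gamma_exp b / 2))) \<le> ereal (norm1w b d idx z / real s powr (gamma_exp b / 2))"
        using feas z by (intro INF_lower) (auto simp: n_def)
    next
      show "ereal (norm1w b d idx z / real s powr (gamma_exp b / 2)) \<le> (INF z\<in>{z \<in> carrier_vec (length idx). norm2 (A *\<^sub>v z - e) \<le> \<eta>}.
          ereal (norm1w b d idx z / real s powr (gamma_exp b / 2)))"
      proof (rule INF_greatest)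
        fix z' assume z': "z' \<in> {z \<in> carrier_vec (length idx). norm2 (A *\<^sub>v z - e) \<le> \<eta>}"
        then have "norm1w b d idx z \<le> norm1w b d idx z'"
          using min[of z'] z by (simp add: h hz n_def)
        then show "ereal (norm1w b d idx z / real s powr (gamma_exp b / 2))
            \<le> ereal (norm1w b d idx z' / real s powr (gamma_exp b / 2))"
          by (simp add: divide_right_mono)
      qed
    qed
  qed
qed

end

(* With B = sqrt (m/n) A^*, the vector z = sqrt (m/n) B (B^* B)^{-1} r solves A z = r and has
   norm2 z <= sqrt (m/n) norm2 r / sigma_m(B); take r to be e shrunk radially by eta.
   Cauchy-Schwarz bounds norm1w z by sqrt |Lambda|_u norm2 z, and |Lambda|_u <= n s^alpha
   because every squared weight on the hyperbolic cross is at most s^alpha.  The upper bound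
   on m then gives the claim for every realization of the sample points, with constant sqrt c2. *)
theory Submission
  imports Defs
begin

section \<open>Euclidean norm, inner product and adjoint\<close>

lemma norm2_nonneg [simp]: "0 \<le> norm2 v"
  by (simp add: norm2_def L2_set_nonneg)

lemma cscalar_prod_self: "v \<bullet>c v = complex_of_real ((norm2 v)\<^sup>2)"
  by (simp add: norm2_def L2_set_def sum_nonneg scalar_prod_def complex_norm_square
      lessThan_atLeast0 flip: of_real_power)

lemma norm2_square: "(norm2 v)\<^sup>2 = Re (v \<bullet>c v)"
  by (simp add: cscalar_prod_self)

lemma norm2_eq_0_iff:
  assumes "v \<in> carrier_vec k"
  shows "norm2 v = 0 \<longleftrightarrow> v = 0\<^sub>v k"
  using cscalar_prod_self[of v] conjugate_square_eq_0_vec[OF assms] by auto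

lemma norm2_smult: "norm2 (a \<cdot>\<^sub>v v) = cmod a * norm2 v"
proof -
  have "norm2 (a \<cdot>\<^sub>v v) = L2_set (\<lambda>k. cmod a * cmod (v $ k)) {..<dim_vec v}"
    unfolding norm2_def by (intro L2_set_cong) (auto simp: norm_mult)
  then show ?thesis by (simp add: norm2_def L2_set_right_distrib)
qed

lemma cmod_cscalar_prod_le:
  assumes "u \<in> carrier_vec k" "v \<in> carrier_vec k"
  shows "cmod (u \<bullet>c v) \<le> norm2 u * norm2 v"
proof -
  have "cmod (u \<bullet>c v) \<le> (\<Sum>i<k. cmod (u $ i) * cmod (v $ i))"
    using assms
    by (auto simp: scalar_prod_def lessThan_atLeast0 norm_mult intro!: sum_norm_le)
  also have "\<dots> \<le> norm2 u * norm2 v"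
    using L2_set_mult_ineq[of "\<lambda>i. cmod (u $ i)" "\<lambda>i. cmod (v $ i)" "{..<k}"] assms
    by (simp add: norm2_def)
  finally show ?thesis .
qed

lemma dim_mat_adjoint [simp]:
  "dim_row (mat_adjoint B) = dim_col B" "dim_col (mat_adjoint B) = dim_row B"
  unfolding mat_adjoint_def by (auto simp: mat_of_rows_def)

lemma mat_adjoint_carrier [simp]:
  "B \<in> carrier_mat n m \<Longrightarrow> mat_adjoint B \<in> carrier_mat m n"
  by auto

lemma index_mat_adjoint [simp]:
  fixes B :: "complex mat"
  assumes "i < dim_col B" "j < dim_row B"
  shows "mat_adjoint B $$ (i, j) = cnj (B $$ (j, i))"
  using assms unfolding mat_adjoint_def by (auto simp: mat_of_rows_def)

text \<open>Conjugation fixes a real scalar. For \<open>B = sqrt (m/n) A^*\<close> this identifies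
  \<open>B^*\<close> as a multiple of \<open>A\<close>, so solving with \<open>B^*\<close> amounts
  to solving with \<open>A\<close>.\<close>

lemma mat_adjoint_smult_adjoint:
  fixes A :: "complex mat"
  shows "mat_adjoint (complex_of_real c \<cdot>\<^sub>m mat_adjoint A) = complex_of_real c \<cdot>\<^sub>m A"
  by (rule eq_matI) auto

lemma cscalar_prod_mat_adjoint:
  fixes B :: "complex mat"
  assumes B: "B \<in> carrier_mat n m" and x: "x \<in> carrier_vec m" and y: "y \<in> carrier_vec n"
  shows "(B *\<^sub>v x) \<bullet>c y = x \<bullet>c (mat_adjoint B *\<^sub>v y)"
proof -
  have "(B *\<^sub>v x) \<bullet>c y = (\<Sum>i<n. \<Sum>j<m. B $$ (i, j) * x $ j * cnj (y $ i))"
    using assms by (simp add: scalar_prod_def lessThan_atLeast0 sum_distrib_right)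
  also have "\<dots> = (\<Sum>j<m. \<Sum>i<n. B $$ (i, j) * x $ j * cnj (y $ i))"
    by (rule sum.swap)
  also have "\<dots> = x \<bullet>c (mat_adjoint B *\<^sub>v y)"
    using assms mat_adjoint_carrier[OF B]
    by (simp add: scalar_prod_def lessThan_atLeast0 sum_distrib_left mult_ac)
  finally show ?thesis .
qed

section \<open>The Rayleigh quotient of \<open>B^* B\<close> and its minimizers\<close>

text \<open>Move the first \<open>B\<close> across the inner product. This passes between norms of
  \<open>B x\<close> and the Gram matrix \<open>B^* B\<close>, whose eigenvalues define the singular
  values.\<close>

lemma norm2_mult_mat_vec_square:
  assumes B: "B \<in> carrier_mat n m" and x: "x \<in> carrier_vec m"
  shows "complex_of_real ((norm2 (B *\<^sub>v x))\<^sup>2) = x \<bullet>c ((mat_adjoint B * B) *\<^sub>v x)"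
  using cscalar_prod_mat_adjoint[OF B x, of "B *\<^sub>v x"] assms mat_adjoint_carrier[OF B]
  by (simp add: cscalar_prod_self assoc_mult_mat_vec[of _ m n _ m])

text \<open>For real \<open>t\<close> the two cross terms are complex conjugates, so the expansion
  is a real quadratic polynomial in \<open>t\<close> and the first variation is its linear
  coefficient.\<close>

lemma norm2_add_smult_square:
  assumes "u \<in> carrier_vec k" "v \<in> carrier_vec k"
  shows "(norm2 (u + complex_of_real t \<cdot>\<^sub>v v))\<^sup>2 =
    (norm2 u)\<^sup>2 + 2 * t * Re (u \<bullet>c v) + t\<^sup>2 * (norm2 v)\<^sup>2"
proof -
  have "(norm2 (u + complex_of_real t \<cdot>\<^sub>v v))\<^sup>2 =
      (\<Sum>i<k. (cmod (u $ i + complex_of_real t * v $ i))\<^sup>2)"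
    using assms by (simp add: norm2_def L2_set_def sum_nonneg)
  also have "\<dots> = (\<Sum>i<k. (cmod (u $ i))\<^sup>2 + 2 * t * Re (u $ i * cnj (v $ i)) + t\<^sup>2 * (cmod (v $ i))\<^sup>2)"
    by (intro sum.cong refl, unfold cmod_power2) (simp add: power2_eq_square algebra_simps)
  also have "\<dots> = (norm2 u)\<^sup>2 + 2 * t * Re (u \<bullet>c v) + t\<^sup>2 * (norm2 v)\<^sup>2"
    using assms by (simp add: norm2_def L2_set_def sum_nonneg scalar_prod_def lessThan_atLeast0
        sum.distrib flip: sum_distrib_left)
  finally show ?thesis .
qed

(* First variation of the Rayleigh quotient at y in the direction of the residual w. *)
lemma rayleigh_minimizer_eigenvector:
  assumes B: "B \<in> carrier_mat n m" and y: "y \<in> carrier_vec m"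
    and min: "\<And>x. x \<in> carrier_vec m \<Longrightarrow> \<mu> * (norm2 x)\<^sup>2 \<le> (norm2 (B *\<^sub>v x))\<^sup>2"
    and eq: "(norm2 (B *\<^sub>v y))\<^sup>2 = \<mu> * (norm2 y)\<^sup>2"
  shows "(mat_adjoint B * B) *\<^sub>v y = complex_of_real \<mu> \<cdot>\<^sub>v y"
proof -
  define g where "g = (mat_adjoint B * B) *\<^sub>v y"
  have g: "g \<in> carrier_vec m"
    using mult_carrier_mat[OF mat_adjoint_carrier[OF B] B] y by (auto simp: g_def)
  define w where "w = g + complex_of_real (- \<mu>) \<cdot>\<^sub>v y"
  have w: "w \<in> carrier_vec m" using g y by (simp add: w_def)
  have Bv: "B *\<^sub>v x \<in> carrier_vec n" if "x \<in> carrier_vec m" for x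
    using B that by auto
  have "w \<bullet>c w = g \<bullet>c w - complex_of_real \<mu> * (y \<bullet>c w)"
  proof -
    have "(g + complex_of_real (- \<mu>) \<cdot>\<^sub>v y) \<bullet> conjugate w = g \<bullet>c w - complex_of_real \<mu> * (y \<bullet>c w)"
      using g y w by (subst add_scalar_prod_distrib[of _ m]) auto
    then show ?thesis by (simp only: w_def[symmetric])
  qed
  moreover have "(B *\<^sub>v y) \<bullet>c (B *\<^sub>v w) = cnj ((B *\<^sub>v w) \<bullet>c (B *\<^sub>v y))"
    using Bv[OF y] Bv[OF w] by (simp add: scalar_prod_def lessThan_atLeast0 mult.commute)
  moreover have "(B *\<^sub>v w) \<bullet>c (B *\<^sub>v y) = w \<bullet>c g"
    using cscalar_prod_mat_adjoint[OF B w Bv[OF y]] mat_adjoint_carrier[OF B] B y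
    by (simp add: g_def assoc_mult_mat_vec[of _ m n _ m])
  moreover have "cnj (w \<bullet>c g) = g \<bullet>c w"
    using g w by (simp add: scalar_prod_def lessThan_atLeast0 mult.commute)
  \<comment> \<open>Half the slope at \<open>t = 0\<close> of
    \<open>(norm2 (B (y + t w)))^2 - \<mu> (norm2 (y + t w))^2\<close> is the squared norm of the
    residual itself, so a nonzero residual is a direction of strict descent.\<close>
  ultimately have cross: "Re ((B *\<^sub>v y) \<bullet>c (B *\<^sub>v w)) - \<mu> * Re (y \<bullet>c w) = (norm2 w)\<^sup>2"
    by (simp add: norm2_square)
  define N where "N = (norm2 w)\<^sup>2"
  define q where "q = (norm2 (B *\<^sub>v w))\<^sup>2 - \<mu> * N"
  have q: "q \<ge> 0" using min[OF w] by (simp add: q_def N_def)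
  \<comment> \<open>Minimality tested at \<open>y + t w\<close>; the terms of order zero cancel
    because \<open>y\<close> attains the bound.\<close>
  have quad: "0 \<le> 2 * t * N + t\<^sup>2 * q" for t
  proof -
    have "B *\<^sub>v (y + complex_of_real t \<cdot>\<^sub>v w) = B *\<^sub>v y + complex_of_real t \<cdot>\<^sub>v (B *\<^sub>v w)"
      using B y w by (simp add: mult_add_distrib_mat_vec[of _ n m] mult_mat_vec[of _ n m])
    then have "\<mu> * ((norm2 y)\<^sup>2 + 2 * t * Re (y \<bullet>c w) + t\<^sup>2 * N) \<le>
        (norm2 (B *\<^sub>v y))\<^sup>2 + 2 * t * Re ((B *\<^sub>v y) \<bullet>c (B *\<^sub>v w)) + t\<^sup>2 * (norm2 (B *\<^sub>v w))\<^sup>2"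
      using min[of "y + complex_of_real t \<cdot>\<^sub>v w"] y w
      by (simp add: norm2_add_smult_square[OF y w] norm2_add_smult_square[OF Bv[OF y] Bv[OF w]] N_def)
    then have "0 \<le> 2 * t * (Re ((B *\<^sub>v y) \<bullet>c (B *\<^sub>v w)) - \<mu> * Re (y \<bullet>c w)) + t\<^sup>2 * q"
      by (simp add: eq q_def algebra_simps)
    then show ?thesis by (simp only: cross N_def)
  qed
  have "N = 0"
  proof (rule ccontr)
    assume "N \<noteq> 0"
    then have N: "N > 0" by (simp add: N_def)
    \<comment> \<open>A small negative \<open>t\<close> makes the linear term dominate. The
      denominator \<open>q + 1\<close> instead of \<open>q\<close> keeps the choice valid when
      \<open>q = 0\<close>.\<close>
    have "2 * (- (N / (q + 1))) * N + (- (N / (q + 1)))\<^sup>2 * q = - (N\<^sup>2 * (q + 2) / (q + 1)\<^sup>2)"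
      using q by (simp add: power2_eq_square divide_simps) (simp add: algebra_simps)
    moreover have "N\<^sup>2 * (q + 2) / (q + 1)\<^sup>2 > 0" using N q by simp
    ultimately show False using quad[of "- (N / (q + 1))"] by linarith
  qed
  then have "w = 0\<^sub>v m" using norm2_eq_0_iff[OF w] by (simp add: N_def)
  then have "w $ i = 0" if "i < m" for i using that by simp
  then have "g = complex_of_real \<mu> \<cdot>\<^sub>v y"
    using g y by (intro eq_vecI) (auto simp: w_def)
  then show ?thesis by (simp add: g_def)
qed

text \<open>A continuous function attains its minimum on the compact unit sphere, and homogeneity
  extends the bound to all vectors. Vectors are modelled as functions on \<open>nat\<close> with the
  product topology, where compactness is Tychonoff's theorem.\<close>

lemma rayleigh_minimizer_exists:
  assumes B: "B \<in> carrier_mat n m" and m: "m > 0"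
  shows "\<exists>\<mu> y. y \<in> carrier_vec m \<and> norm2 y = 1 \<and> (norm2 (B *\<^sub>v y))\<^sup>2 = \<mu> \<and>
    (\<forall>x\<in>carrier_vec m. \<mu> * (norm2 x)\<^sup>2 \<le> (norm2 (B *\<^sub>v x))\<^sup>2)"
proof -
  define h where "h f = L2_set (\<lambda>j. cmod (f j)) {..<m}" for f :: "nat \<Rightarrow> complex"
  define g where "g f = L2_set (\<lambda>k. cmod (\<Sum>j<m. B $$ (k, j) * f j)) {..<n}" for f :: "nat \<Rightarrow> complex"
  have hv: "norm2 (vec m f) = h f" for f
    unfolding norm2_def h_def by (intro L2_set_cong) auto
  have gv: "norm2 (B *\<^sub>v vec m f) = g f" for f
    unfolding norm2_def g_def using B
    by (intro L2_set_cong) (auto simp: scalar_prod_def lessThan_atLeast0)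
  have hcont: "continuous_on UNIV h" unfolding h_def L2_set_def
    by (intro continuous_intros continuous_on_product_coordinates)
  have gcont: "continuous_on UNIV g" unfolding g_def L2_set_def
    by (intro continuous_intros continuous_on_product_coordinates)
  define K where "K = PiE (UNIV :: nat set) (\<lambda>_. cball (0::complex) 1)"
  have "compact K"
    unfolding K_def compactin_euclidean_iff[symmetric] euclidean_product_topology[symmetric]
    by (subst compactin_PiE) auto
  moreover have "closed {f. h f = 1}"
    using hcont by (intro closed_Collect_eq continuous_on_const) auto
  ultimately have comp: "compact (K \<inter> {f. h f = 1})" by (rule compact_Int_closed)
  \<comment> \<open>The condition \<open>h f = 1\<close> leaves the coordinates from
    \<open>m\<close> on free, so it alone does not describe a compact set. Setting them to zero
    changes neither \<open>h\<close> nor \<open>g\<close> and puts the function into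
    \<open>K\<close>.\<close>
  have inK: "(\<lambda>j. if j < m then f j else 0) \<in> K \<inter> {f. h f = 1}" if "h f = 1" for f
  proof -
    have "cmod (f j) \<le> h f" if "j < m" for j
      unfolding h_def using that by (intro member_le_L2_set) auto
    moreover have "h (\<lambda>j. if j < m then f j else 0) = h f"
      unfolding h_def by (intro L2_set_cong) auto
    ultimately show ?thesis using that by (auto simp: K_def)
  qed
  \<comment> \<open>The first unit vector, present because \<open>m > 0\<close>, shows that the
    sphere is nonempty.\<close>
  have "h (\<lambda>j. if j = 0 then 1 else 0) = 1"
    using m by (simp add: h_def L2_set_def if_distrib[of cmod] if_distrib[of "\<lambda>x. x\<^sup>2"] cong: if_cong)
  then have "K \<inter> {f. h f = 1} \<noteq> {}" using inK by blast
  then obtain f where f: "h f = 1" "\<And>f'. f' \<in> K \<inter> {f. h f = 1} \<Longrightarrow> g f \<le> g f'"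
    using continuous_attains_inf[OF comp _ continuous_on_subset[OF gcont]] by blast
  have "(g f)\<^sup>2 * (norm2 x)\<^sup>2 \<le> (norm2 (B *\<^sub>v x))\<^sup>2" if x: "x \<in> carrier_vec m" for x
  proof (cases "norm2 x = 0")
    case False
    then have pos: "norm2 x > 0" using norm2_nonneg[of x] by linarith
    define u where "u = complex_of_real (1 / norm2 x) \<cdot>\<^sub>v x"
    have u: "vec m (vec_index u) = u" using x by (auto simp: u_def)
    have "norm2 u = 1" using pos by (simp add: u_def norm2_smult norm_divide)
    then have hu: "h (vec_index u) = 1" using hv[of "vec_index u"] by (simp add: u)
    have "g f \<le> g (\<lambda>j. if j < m then u $ j else 0)" by (intro f inK hu)
    also have "\<dots> = g (vec_index u)" unfolding g_def by (intro L2_set_cong) auto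
    also have "\<dots> = norm2 (B *\<^sub>v u)" using gv[of "vec_index u"] by (simp add: u)
    also have "\<dots> = norm2 (B *\<^sub>v x) / norm2 x"
      using B x pos by (simp add: u_def mult_mat_vec[of _ n m] norm2_smult norm_divide)
    finally have "g f * norm2 x \<le> norm2 (B *\<^sub>v x)" using pos by (simp add: field_simps)
    moreover have "0 \<le> g f" by (simp add: g_def L2_set_nonneg)
    ultimately have "(g f * norm2 x)\<^sup>2 \<le> (norm2 (B *\<^sub>v x))\<^sup>2" by (intro power_mono) auto
    then show ?thesis by (simp add: power_mult_distrib)
  qed auto
  then show ?thesis
    using f(1) by (intro exI[of _ "(g f)\<^sup>2"] exI[of _ "vec m f"]) (auto simp: hv gv)
qed

section \<open>The smallest singular value\<close>

text \<open>The characteristic polynomial is monic of degree \<open>m\<close> and splits over the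
  complex numbers. Hence the list of singular values has exactly \<open>m\<close> entries, each
  coming from an eigenvalue.\<close>

lemma proots_char_poly_adjoint_mult:
  fixes B :: "complex mat"
  assumes B: "B \<in> carrier_mat n m"
  shows "x \<in># proots (char_poly (mat_adjoint B * B)) \<longleftrightarrow> eigenvalue (mat_adjoint B * B) x"
    and "size (proots (char_poly (mat_adjoint B * B))) = m"
proof -
  have G: "mat_adjoint B * B \<in> carrier_mat m m"
    using mult_carrier_mat[OF mat_adjoint_carrier[OF B] B] .
  then have "char_poly (mat_adjoint B * B) \<noteq> 0"
    using degree_monic_char_poly[OF G] by auto
  then show "x \<in># proots (char_poly (mat_adjoint B * B)) \<longleftrightarrow> eigenvalue (mat_adjoint B * B) x"
    using eigenvalue_root_char_poly[OF G] by simp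
  show "size (proots (char_poly (mat_adjoint B * B))) = m"
    using degree_monic_char_poly[OF G] size_proots_complex by metis
qed

lemma eigenvalue_adjoint_mult_nonneg:
  assumes B: "B \<in> carrier_mat n m" and "eigenvalue (mat_adjoint B * B) x"
  shows "0 \<le> Re x"
proof -
  have G: "mat_adjoint B * B \<in> carrier_mat m m"
    using mult_carrier_mat[OF mat_adjoint_carrier[OF B] B] .
  obtain v where v: "v \<in> carrier_vec m" "v \<noteq> 0\<^sub>v m" "(mat_adjoint B * B) *\<^sub>v v = x \<cdot>\<^sub>v v"
    using assms G by (auto simp: eigenvalue_def eigenvector_def)
  \<comment> \<open>The eigenvalue leaves the conjugated second argument, hence
    \<open>cnj x\<close>; only its real part matters afterwards.\<close>
  have "complex_of_real ((norm2 (B *\<^sub>v v))\<^sup>2) = cnj x * complex_of_real ((norm2 v)\<^sup>2)"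
    unfolding norm2_mult_mat_vec_square[OF B v(1)] using v(1)
    by (simp only: v(3) cscalar_prod_self[symmetric]) (simp add: conjugate_smult_vec)
  then have "Re (complex_of_real ((norm2 (B *\<^sub>v v))\<^sup>2)) = Re (cnj x * complex_of_real ((norm2 v)\<^sup>2))"
    by (rule arg_cong)
  then have "(norm2 (B *\<^sub>v v))\<^sup>2 = Re x * (norm2 v)\<^sup>2" by simp
  moreover have "0 < (norm2 v)\<^sup>2" using v norm2_eq_0_iff[OF v(1)] by simp
  ultimately show ?thesis by (metis zero_le_power2 zero_le_mult_iff not_less)
qed

text \<open>The minimum \<open>\<mu>\<close> of the Rayleigh quotient is an eigenvalue of
  \<open>B^* B\<close>, so \<open>sqrt \<mu>\<close> occurs among the singular values and is at
  least the smallest of them.\<close>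

lemma smallest_singular_value:
  assumes B: "B \<in> carrier_mat n m" and m: "m > 0"
  shows "0 \<le> singular_value m B"
    and "x \<in> carrier_vec m \<Longrightarrow> singular_value m B * norm2 x \<le> norm2 (B *\<^sub>v x)"
proof -
  define S where "S = image_mset (\<lambda>x. sqrt (Re x)) (proots (char_poly (mat_adjoint B * B)))"
  have size: "size S = m" by (simp add: S_def proots_char_poly_adjoint_mult[OF B])
  define L where "L = sorted_list_of_multiset S"
  have mset: "mset L = S" by (simp add: L_def)
  then have len: "length L = m" using size by (metis size_mset)
  \<comment> \<open>The list has \<open>m\<close> entries in decreasing order, so its
    \<open>m\<close>-th entry, at position \<open>m - 1\<close>, is the head of the increasing list
    \<open>L\<close>.\<close>
  have sv: "singular_value m B = L ! 0"
    using m len by (simp add: singular_value_def singular_values_def rev_nth flip: S_def L_def)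
  have "L ! 0 \<in># S" using len m mset by (metis nth_mem set_mset_mset)
  then show nonneg: "0 \<le> singular_value m B"
    using eigenvalue_adjoint_mult_nonneg[OF B]
    by (auto simp: sv S_def proots_char_poly_adjoint_mult[OF B])
  assume x: "x \<in> carrier_vec m"
  obtain \<mu> y where y: "y \<in> carrier_vec m" "norm2 y = 1" "(norm2 (B *\<^sub>v y))\<^sup>2 = \<mu>"
    and min: "\<forall>x\<in>carrier_vec m. \<mu> * (norm2 x)\<^sup>2 \<le> (norm2 (B *\<^sub>v x))\<^sup>2"
    using rayleigh_minimizer_exists[OF B m] by blast
  have "(mat_adjoint B * B) *\<^sub>v y = complex_of_real \<mu> \<cdot>\<^sub>v y"
    using y min by (intro rayleigh_minimizer_eigenvector[OF B]) auto
  moreover have "y \<noteq> 0\<^sub>v m" using y norm2_eq_0_iff[OF y(1)] by auto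
  ultimately have "eigenvalue (mat_adjoint B * B) (complex_of_real \<mu>)"
    using y(1) B by (auto simp: eigenvalue_def eigenvector_def intro!: exI[of _ y])
  then have "sqrt \<mu> \<in># S"
    unfolding S_def set_image_mset
    by (intro image_eqI[of _ _ "complex_of_real \<mu>"]) (auto simp: proots_char_poly_adjoint_mult[OF B])
  then obtain i where "i < m" "L ! i = sqrt \<mu>"
    using mset len by (metis in_set_conv_nth set_mset_mset)
  then have "singular_value m B \<le> sqrt \<mu>"
    using sorted_nth_mono[of L 0 i] len by (simp add: sv L_def)
  then have "singular_value m B * norm2 x \<le> sqrt \<mu> * norm2 x"
    by (intro mult_right_mono) auto
  also have "\<dots> = sqrt (\<mu> * (norm2 x)\<^sup>2)" by (simp add: real_sqrt_mult)
  also have "\<dots> \<le> norm2 (B *\<^sub>v x)" using min x by (intro real_le_lsqrt) auto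
  finally show "singular_value m B * norm2 x \<le> norm2 (B *\<^sub>v x)" .
qed

section \<open>Solving with the adjoint at controlled norm\<close>

text \<open>Take \<open>z = B y\<close> with \<open>B^* B y = r\<close>. Then
  \<open>(norm2 z)^2\<close> is the inner product of \<open>y\<close> and \<open>r\<close>, at most
  \<open>norm2 y * norm2 r\<close>, while \<open>\<sigma> * norm2 y \<le> norm2 z\<close>; one
  factor \<open>norm2 z\<close> cancels.\<close>

lemma mat_adjoint_right_inverse_bound:
  assumes B: "B \<in> carrier_mat n m" and m: "m > 0" and r: "r \<in> carrier_vec m"
    and \<sigma>: "singular_value m B \<noteq> 0"
  shows "\<exists>z\<in>carrier_vec n. mat_adjoint B *\<^sub>v z = r \<and> norm2 z \<le> norm2 r / singular_value m B"
proof -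
  let ?G = "mat_adjoint B * B" and ?\<sigma> = "singular_value m B"
  have G: "?G \<in> carrier_mat m m"
    using mult_carrier_mat[OF mat_adjoint_carrier[OF B] B] .
  have pos: "?\<sigma> > 0" using smallest_singular_value(1)[OF B m] \<sigma> by simp
  \<comment> \<open>A kernel vector of the Gram matrix is a kernel vector of \<open>B\<close>, which
    the positive lower bound by the smallest singular value excludes.\<close>
  have "det ?G \<noteq> 0"
  proof
    assume "det ?G = 0"
    then obtain v where v: "v \<in> carrier_vec m" "v \<noteq> 0\<^sub>v m" "?G *\<^sub>v v = 0\<^sub>v m"
      using det_0_iff_vec_prod_zero[OF G] by blast
    have "norm2 (B *\<^sub>v v) = 0"
      using norm2_mult_mat_vec_square[OF B v(1)] v by simp
    moreover have "norm2 v > 0"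
      using v norm2_eq_0_iff[OF v(1)] norm2_nonneg[of v] by linarith
    ultimately show False
      using smallest_singular_value(2)[OF B m v(1)] mult_pos_pos[OF pos] by fastforce
  qed
  \<comment> \<open>The argument \<open>()\<close> only fixes the record extension of
    \<open>ring_mat\<close>; being a unit of that ring supplies the inverse.\<close>
  then obtain H where H: "H \<in> carrier_mat m m" "?G * H = 1\<^sub>m m"
    using det_non_zero_imp_unit[OF G, of "()"] by (auto simp: Units_def ring_mat_def)
  define y where "y = H *\<^sub>v r"
  have y: "y \<in> carrier_vec m" using H r by (auto simp: y_def)
  have Gy: "?G *\<^sub>v y = r"
    unfolding y_def using H r by (simp flip: assoc_mult_mat_vec[OF G H(1) r])
  define z where "z = B *\<^sub>v y"
  have z: "z \<in> carrier_vec n" using B y by (auto simp: z_def)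
  have adj: "mat_adjoint B *\<^sub>v z = r"
    using Gy B y by (simp add: z_def assoc_mult_mat_vec[of _ m n _ m])
  have sy: "?\<sigma> * norm2 y \<le> norm2 z" 
    using smallest_singular_value(2)[OF B m y] by (simp add: z_def)
  have "(norm2 z)\<^sup>2 = cmod (complex_of_real ((norm2 z)\<^sup>2))" by (simp add: norm_power)
  also have "\<dots> = cmod (y \<bullet>c r)" 
    using norm2_mult_mat_vec_square[OF B y] by (simp only: z_def Gy)
  also have "\<dots> \<le> norm2 y * norm2 r" by (rule cmod_cscalar_prod_le[OF y r])
  finally have "?\<sigma> * (norm2 z)\<^sup>2 \<le> ?\<sigma> * norm2 y * norm2 r" using pos by simp
  also have "\<dots> \<le> norm2 z * norm2 r" using sy by (intro mult_right_mono) auto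
  finally have "norm2 z * (?\<sigma> * norm2 z) \<le> norm2 z * norm2 r"
    by (simp add: power2_eq_square mult_ac)
  \<comment> \<open>If \<open>norm2 z = 0\<close> there is nothing to cancel, but then the left side
    is zero.\<close>
  then have "?\<sigma> * norm2 z \<le> norm2 r"
    using norm2_nonneg[of z] norm2_nonneg[of r] by (cases "norm2 z = 0") auto
  then show ?thesis using z adj pos by (intro bexI[of _ z]) (auto simp: field_simps)
qed

section \<open>Weights on the hyperbolic cross\<close>

text \<open>Compare factor by factor with the product bounded by \<open>s\<close>. In the Legendre
  case \<open>2 k + 1 \<le> (k + 1)^2\<close>, which costs the square of that product; in the
  Chebyshev case the squared factor is 1 for \<open>k = 0\<close> and 2 otherwise, at most
  \<open>k + 1\<close>. This is the origin of \<open>alpha_exp\<close>.\<close>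

lemma weight_square_le_hyperbolic_cross:
  assumes i: "i \<in> hyperbolic_cross d s" and s: "s > 0"
  shows "(weight b d i)\<^sup>2 \<le> real s powr alpha_exp b"
proof -
  have p: "(\<Prod>l<d. real (i l) + 1) \<le> real s"
  proof -
    have "real (\<Prod>l<d. i l + 1) \<le> real s" using i by (simp only: hyperbolic_cross_def of_nat_le_iff mem_Collect_eq)
    then show ?thesis by (simp add: add.commute)
  qed
  show ?thesis
  proof (cases b)
    case Legendre
    have "(weight b d i)\<^sup>2 = (\<Prod>l<d. 2 * real (i l) + 1)"
      by (simp add: Legendre weight_Legendre prod_power_distrib)
    also have "\<dots> \<le> (\<Prod>l<d. (real (i l) + 1)\<^sup>2)"
      by (intro prod_mono) (auto simp: power2_eq_square algebra_simps)
    also have "\<dots> = (\<Prod>l<d. real (i l) + 1)\<^sup>2" by (simp add: prod_power_distrib)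
    also have "\<dots> \<le> (real s)\<^sup>2" using p by (intro power_mono prod_nonneg) auto
    finally show ?thesis using s by (simp add: Legendre)
  next
    case Chebyshev
    have "(weight b d i)\<^sup>2 = (\<Prod>l<d. (phi1 Chebyshev (i l) 1)\<^sup>2)"
      unfolding Chebyshev weight_eq_prod by (rule prod_power_distrib)
    also have "\<dots> \<le> (\<Prod>l<d. real (i l) + 1)"
      by (intro prod_mono) (auto simp: chebyshev_T_def power_mult_distrib)
    also note p
    finally show ?thesis using s by (simp add: Chebyshev)
  qed
qed

lemma norm1w_le_norm2:
  assumes idx: "set idx \<subseteq> hyperbolic_cross d s" and s: "s > 0"
    and z: "z \<in> carrier_vec (length idx)"
  shows "norm1w b d idx z \<le> sqrt (real (length idx)) * real s powr (alpha_exp b / 2) * norm2 z"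
proof -
  let ?w = "\<lambda>j. weight b d (idx ! j)" and ?n = "length idx"
  have "L2_set ?w {..<?n} \<le> sqrt (\<Sum>j<?n. real s powr alpha_exp b)"
    unfolding L2_set_def using idx s
    by (intro real_sqrt_le_mono sum_mono weight_square_le_hyperbolic_cross) auto
  also have "\<dots> = sqrt (real ?n) * real s powr (alpha_exp b / 2)"
    by (simp add: real_sqrt_mult powr_half_sqrt[symmetric] powr_powr)
  finally have *: "L2_set ?w {..<?n} \<le> sqrt (real ?n) * real s powr (alpha_exp b / 2)" .
  have "norm1w b d idx z \<le> L2_set ?w {..<?n} * norm2 z"
    using L2_set_mult_ineq[of ?w "\<lambda>j. cmod (z $ j)" "{..<?n}"] z weight_pos[of b d]
    by (simp add: norm1w_def norm2_def less_imp_le)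
  also have "\<dots> \<le> sqrt (real ?n) * real s powr (alpha_exp b / 2) * norm2 z"
    using * by (intro mult_right_mono) auto
  finally show ?thesis .
qed

section \<open>The bound for a fixed sampling matrix and the conclusion\<close>

lemma Tquant_le:
  assumes "z \<in> carrier_vec (length idx)" "norm2 (A *\<^sub>v z - e) \<le> \<eta>"
  shows "Tquant b d s idx A e \<eta> \<le> ereal (norm1w b d idx z / real s powr (gamma_exp b / 2))"
  unfolding Tquant_def using assms by (intro INF_lower) auto

text \<open>The deterministic core, for one matrix and one data vector outside the ball of radius
  \<open>\<eta>\<close>; \<open>K\<close> stands for the factor \<open>Lfac\<close>.\<close>

lemma Tquant_le_singular_value:
  assumes idx: "set idx \<subseteq> hyperbolic_cross d s" "length idx = n" and n: "n > 0" and s: "s > 0"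
    and A: "A \<in> carrier_mat m n" and e: "e \<in> carrier_vec m"
    and \<eta>: "0 \<le> \<eta>" "\<eta> < norm2 e" and m: "real m \<le> c * (real s powr gamma_exp b * K)"
    and \<sigma>_def: "\<sigma> = singular_value m (complex_of_real (sqrt (real m / real n)) \<cdot>\<^sub>m mat_adjoint A)"
    and \<sigma>: "\<sigma> \<noteq> 0"
  shows "Tquant b d s idx A e \<eta> \<le>
    ereal (sqrt c * (real s powr (alpha_exp b / 2) * sqrt K / \<sigma> * (norm2 e - \<eta>)))"
proof -
  define N where "N = norm2 e"
  have N: "N > 0" "\<eta> < N" using \<eta> by (auto simp: N_def)
  \<comment> \<open>For \<open>m = 0\<close> the vector \<open>e\<close> is empty and has norm 0,
    contrary to \<open>0 \<le> \<eta> < norm2 e\<close>.\<close>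
  have m0: "m > 0"
  proof (rule ccontr)
    assume "\<not> m > 0"
    then show False using N e by (simp add: N_def norm2_def)
  qed
  define a where "a = sqrt (real m / real n)"
  have a: "a > 0" using m0 n by (simp add: a_def)
  define B where "B = complex_of_real a \<cdot>\<^sub>m mat_adjoint A"
  have B: "B \<in> carrier_mat n m" using A by (simp add: B_def)
  have \<sigma>B: "\<sigma> = singular_value m B" by (simp add: \<sigma>_def B_def a_def)
  have pos: "\<sigma> > 0" using smallest_singular_value(1)[OF B m0] \<sigma> by (simp add: \<sigma>B)
  \<comment> \<open>The point nearest to the origin in the closed ball of radius
    \<open>\<eta>\<close> about \<open>e\<close>.\<close>
  define r where "r = complex_of_real ((N - \<eta>) / N) \<cdot>\<^sub>v e"
  have r: "r \<in> carrier_vec m" using e by (simp add: r_def)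
  have nr: "norm2 r = N - \<eta>"
    unfolding r_def norm2_smult norm_of_real using N by (simp add: N_def[symmetric])
  obtain z where z: "z \<in> carrier_vec n" "mat_adjoint B *\<^sub>v z = r" "norm2 z \<le> (N - \<eta>) / \<sigma>"
    using mat_adjoint_right_inverse_bound[OF B m0 r] \<sigma> by (auto simp: \<sigma>B nr)
  \<comment> \<open>Since \<open>B^* = a A\<close>, the factor \<open>a\<close> moves from the
    matrix to the vector.\<close>
  define z' where "z' = complex_of_real a \<cdot>\<^sub>v z"
  have z': "z' \<in> carrier_vec n" using z by (simp add: z'_def)
  have Az': "A *\<^sub>v z' = r"
  proof -
    have "A *\<^sub>v z' = (complex_of_real a \<cdot>\<^sub>m A) *\<^sub>v z"
      using z(1) A by (intro eq_vecI) (auto simp: z'_def)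
    then show ?thesis using z(2) by (simp add: B_def mat_adjoint_smult_adjoint)
  qed
  have "r - e = complex_of_real (- (\<eta> / N)) \<cdot>\<^sub>v e"
    using e N by (intro eq_vecI) (auto simp: r_def field_simps)
  then have "norm2 (A *\<^sub>v z' - e) = \<bar>- (\<eta> / N)\<bar> * N"
    by (simp only: Az' norm2_smult norm_of_real N_def)
  also have "\<dots> = \<eta>" using N \<eta> by simp
  finally have "Tquant b d s idx A e \<eta> \<le> ereal (norm1w b d idx z' / real s powr (gamma_exp b / 2))"
    using z' idx by (intro Tquant_le) auto
  also have "norm1w b d idx z' / real s powr (gamma_exp b / 2) \<le>
      sqrt c * (real s powr (alpha_exp b / 2) * sqrt K / \<sigma> * (N - \<eta>))"
  proof -
    have "norm2 z' = a * norm2 z" using a by (simp add: z'_def norm2_smult)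
    then have z'n: "norm2 z' \<le> a * ((N - \<eta>) / \<sigma>)" 
      using mult_left_mono[OF z(3), of a] a by simp
    have "norm1w b d idx z' \<le> sqrt (real n) * real s powr (alpha_exp b / 2) * norm2 z'"
      using norm1w_le_norm2[OF idx(1) s] z' idx(2) by simp
    also have "\<dots> \<le> sqrt (real n) * real s powr (alpha_exp b / 2) * (a * ((N - \<eta>) / \<sigma>))"
      using z'n by (intro mult_left_mono) auto
    \<comment> \<open>The \<open>sqrt n\<close> from counting the weights cancels against the
      denominator of \<open>a = sqrt (m/n)\<close>.\<close>
    also have "\<dots> = sqrt (real m) * (real s powr (alpha_exp b / 2) * (N - \<eta>) / \<sigma>)"
      using n by (simp add: a_def real_sqrt_divide)
    \<comment> \<open>The upper bound on \<open>m\<close> produces \<open>s\<close> to the power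
      \<open>gamma_exp b / 2\<close>, which the normalization in \<open>Tquant\<close>
      removes.\<close>
    also have "\<dots> \<le> sqrt (c * (real s powr gamma_exp b * K)) * (real s powr (alpha_exp b / 2) * (N - \<eta>) / \<sigma>)"
      using m N pos by (intro mult_right_mono real_sqrt_le_mono) auto
    also have "sqrt (c * (real s powr gamma_exp b * K)) = sqrt c * sqrt K * real s powr (gamma_exp b / 2)"
      by (simp add: real_sqrt_mult powr_half_sqrt[symmetric] powr_powr)
    finally show ?thesis using s by (simp add: field_simps)
  qed
  finally show ?thesis by (simp add: N_def)
qed

theorem theorem5p11:
  fixes c1 c2 :: real
  assumes "c1 > 0" and "c2 > 0"
  shows "\<exists>C>0. \<forall>(b :: basis) (d :: nat) (s :: nat) (\<delta> :: real) (\<epsilon> :: real)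
      (idx :: (nat \<Rightarrow> nat) list) (n :: nat) (m :: nat) (M :: 'w measure) X.
    d \<ge> 1 \<and> 0 < \<epsilon> \<and> \<epsilon> < 1 \<and> 0 < \<delta> \<and> \<delta> < 1 \<and> 2 \<le> s \<and> s \<le> 2 ^ (d + 1) \<and>
    distinct idx \<and> set idx = hyperbolic_cross d s \<and> n = length idx \<and> m < n \<and>
    c1 * (real s powr gamma_exp b * Lfac b d s n \<delta> \<epsilon>) \<le> real m \<and>
    real m \<le> c2 * (real s powr gamma_exp b * Lfac b d s n \<delta> \<epsilon>) \<and>
    prob_space M \<and>
    prob_space.indep_vars M (\<lambda>_. nu b d) X {..<m} \<and>
    (\<forall>k<m. distr M (nu b d) (X k) = nu b d)
    \<longrightarrow>
    (\<forall>\<omega>\<in>space M. \<forall>e\<in>carrier_vec m. \<forall>\<eta>\<ge>0.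
      let A = sampling_matrix b d idx m (\<lambda>k. X k \<omega>);
          \<sigma> = singular_value m (complex_of_real (sqrt (real m / real n)) \<cdot>\<^sub>m mat_adjoint A)
      in Tquant b d s idx A e \<eta> \<le>
           (if \<sigma> = 0 then (if norm2 e > \<eta> then \<infinity> else 0)
            else ereal (C * (real s powr (alpha_exp b / 2) * sqrt (Lfac b d s n \<delta> \<epsilon>) / \<sigma>
                             * max (norm2 e - \<eta>) 0))))"
proof (intro exI[of _ "sqrt c2"] conjI allI impI ballI)
  show "sqrt c2 > 0" using assms by simp
next
  fix b :: basis and d s :: nat and \<delta> \<epsilon> :: real and idx :: "(nat \<Rightarrow> nat) list" and n m :: nat
    and M :: "'w measure" and X \<omega> and e :: "complex vec" and \<eta> :: real
  assume H: "d \<ge> 1 \<and> 0 < \<epsilon> \<and> \<epsilon> < 1 \<and> 0 < \<delta> \<and> \<delta> < 1 \<and> 2 \<le> s \<and> s \<le> 2 ^ (d + 1) \<and>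
    distinct idx \<and> set idx = hyperbolic_cross d s \<and> n = length idx \<and> m < n \<and>
    c1 * (real s powr gamma_exp b * Lfac b d s n \<delta> \<epsilon>) \<le> real m \<and>
    real m \<le> c2 * (real s powr gamma_exp b * Lfac b d s n \<delta> \<epsilon>) \<and>
    prob_space M \<and>
    prob_space.indep_vars M (\<lambda>_. nu b d) X {..<m} \<and>
    (\<forall>k<m. distr M (nu b d) (X k) = nu b d)"
    and e: "e \<in> carrier_vec m" and \<eta>: "0 \<le> \<eta>"
  define A where "A = sampling_matrix b d idx m (\<lambda>k. X k \<omega>)"
  define \<sigma> where "\<sigma> = singular_value m (complex_of_real (sqrt (real m / real n)) \<cdot>\<^sub>m mat_adjoint A)"
  have A: "A \<in> carrier_mat m n" using H by (simp add: A_def sampling_matrix_def)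
  have "Tquant b d s idx A e \<eta> \<le>
           (if \<sigma> = 0 then (if norm2 e > \<eta> then \<infinity> else 0)
            else ereal (sqrt c2 * (real s powr (alpha_exp b / 2) * sqrt (Lfac b d s n \<delta> \<epsilon>) / \<sigma>
                             * max (norm2 e - \<eta>) 0)))"
  proof (cases "norm2 e > \<eta>")
    \<comment> \<open>If \<open>\<sigma> = 0\<close> the right side is infinite; otherwise the
      maximum is \<open>norm2 e - \<eta>\<close> and the deterministic bound applies.\<close>
    case True
    moreover have "n > 0" using H by linarith
    ultimately show ?thesis
      using Tquant_le_singular_value[of idx d s n A m e \<eta> c2 b "Lfac b d s n \<delta> \<epsilon>" \<sigma>] A e \<eta> H \<sigma>_def
      by auto
  next
    \<comment> \<open>Here \<open>z = 0\<close> is feasible and gives the value 0, which is the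
      right side both for \<open>\<sigma> = 0\<close> and for
      \<open>\<sigma> \<noteq> 0\<close>.\<close>
    case False
    have "A *\<^sub>v 0\<^sub>v n - e = complex_of_real (- 1) \<cdot>\<^sub>v e"
      using A e by (intro eq_vecI) auto
    then have "norm2 (A *\<^sub>v 0\<^sub>v n - e) = norm2 e"
      by (simp add: norm2_smult)
    then have "Tquant b d s idx A e \<eta> \<le> ereal (norm1w b d idx (0\<^sub>v n) / real s powr (gamma_exp b / 2))"
      using False H by (intro Tquant_le) auto
    also have "norm1w b d idx (0\<^sub>v n) = 0" using H by (simp add: norm1w_def)
    finally show ?thesis using False by (simp add: zero_ereal_def)
  qed
  then show "let A = sampling_matrix b d idx m (\<lambda>k. X k \<omega>);
          \<sigma> = singular_value m (complex_of_real (sqrt (real m / real n)) \<cdot>\<^sub>m mat_adjoint A)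
      in Tquant b d s idx A e \<eta> \<le>
           (if \<sigma> = 0 then (if norm2 e > \<eta> then \<infinity> else 0)
            else ereal (sqrt c2 * (real s powr (alpha_exp b / 2) * sqrt (Lfac b d s n \<delta> \<epsilon>) / \<sigma>
                             * max (norm2 e - \<eta>) 0)))"
    unfolding Let_def \<sigma>_def A_def .
qed

end
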